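(* If $\ell>k\geq2$, $\tau\in\mathbb M_k$, and $m=|\tau|$, then $\uparrow^{\ell}_{k}m\geq|\uparrow^{\ell}\tau|$.
   Context: For $k\ge2$, $\mathbb M_k$ is the set of base $k$ terms of the multiplicative notation system $\mathcal M$: the least set containing the constants $0$ and $1$ and closed under $\sigma,\tau\mapsto\sigma+\tau$ and $\tau\mapsto k\cdot\tau$ (multiplication by the base $k$ is a unary operation). Terms are identified modulo associativity of $+$. The value $|\tau|\in\mathbb N$ is the natural number obtained by evaluating the term. For $q\in\mathbb N$, $\bar 0=0$ and for $q>0$, $\bar q=1+\cdots+1$ ($q$ times). Normal forms: given $m\in\mathbb N$, let $p,q$ be the unique natural numbers with $q<k$ and $m=k\cdot p+q$. If $p=0$, set $\mathrm{nf}_k(m)=\bar q$; if $p>0$ set, inductively, $\mathrm{nf}_k(m)=k\cdot\mathrm{nf}_k(p)+\bar q$, where the summand $\bar q$ is omitted if $q=0$. For $\tau\in\mathbb M_k$, the base change $\uparrow^\ell\tau\in\mathbb M_\ell$ is the result of replacing every operation $k\cdot(\,)$ in $\tau$ by $\ell\cdot(\,)$: $\uparrow^\ell 0=0$, $\uparrow^\ell1=1$, $\uparrow^\ell(\sigma+\tau)=\uparrow^\ell\sigma+\uparrow^\ell\tau$, $\uparrow^\ell(k\cdot\tau)=\ell\cdot\uparrow^\ell\tau$. For $m\in\mathbb N$, $\uparrow^\ell_k m=|\uparrow^\ell\mathrm{nf}_k(m)|$. *)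

theory Defs
  imports Main
begin

text \<open>
  Raw terms over all bases: \<open>RMul k t\<close> is the unary operation \<open>k \<cdot> t\<close>.
  The set of base \<open>k\<close> terms is \<open>mterms k\<close> below, in which all multiplications have base \<open>k\<close>.
\<close>

datatype raw_term = RZero | ROne | RAdd raw_term raw_term | RMul nat raw_term

text \<open>The congruence generated by associativity of addition; terms are its equivalence classes.\<close>

inductive assoc_eq :: "raw_term \<Rightarrow> raw_term \<Rightarrow> bool" where
  refl: "assoc_eq s s"
| sym: "assoc_eq s t \<Longrightarrow> assoc_eq t s"
| trans: "assoc_eq s t \<Longrightarrow> assoc_eq t u \<Longrightarrow> assoc_eq s u"
| assoc: "assoc_eq (RAdd (RAdd s t) u) (RAdd s (RAdd t u))"
| add: "assoc_eq s s' \<Longrightarrow> assoc_eq t t' \<Longrightarrow> assoc_eq (RAdd s t) (RAdd s' t')"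
| mul: "assoc_eq s s' \<Longrightarrow> assoc_eq (RMul k s) (RMul k s')"

quotient_type mterm = raw_term / assoc_eq
  by (auto intro!: equivpI reflpI sympI transpI intro: assoc_eq.refl assoc_eq.sym assoc_eq.trans)

lift_definition TZero :: mterm is RZero .
lift_definition TOne :: mterm is ROne .
lift_definition TAdd :: "mterm \<Rightarrow> mterm \<Rightarrow> mterm" (infixl "\<oplus>" 65) is RAdd
  by (rule assoc_eq.add)
lift_definition TMul :: "nat \<Rightarrow> mterm \<Rightarrow> mterm" (infixr "\<odot>" 70) is RMul
  by (rule assoc_eq.mul)

lemma TAdd_assoc: "(\<sigma> \<oplus> \<tau>) \<oplus> \<upsilon> = \<sigma> \<oplus> (\<tau> \<oplus> \<upsilon>)"
  by transfer (rule assoc_eq.assoc)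

inductive_set mterms :: "nat \<Rightarrow> mterm set" for k :: nat where
  zero: "TZero \<in> mterms k"
| one: "TOne \<in> mterms k"
| add: "\<sigma> \<in> mterms k \<Longrightarrow> \<tau> \<in> mterms k \<Longrightarrow> \<sigma> \<oplus> \<tau> \<in> mterms k"
| mul: "\<tau> \<in> mterms k \<Longrightarrow> k \<odot> \<tau> \<in> mterms k"

primrec raw_value :: "raw_term \<Rightarrow> nat" where
  "raw_value RZero = 0"
| "raw_value ROne = 1"
| "raw_value (RAdd s t) = raw_value s + raw_value t"
| "raw_value (RMul k t) = k * raw_value t"

lift_definition tvalue :: "mterm \<Rightarrow> nat" is raw_value
  by (erule assoc_eq.induct) auto

lemma tvalue_simps [simp]:
  "tvalue TZero = 0"
  "tvalue TOne = 1"
  "tvalue (\<sigma> \<oplus> \<tau>) = tvalue \<sigma> + tvalue \<tau>"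
  "tvalue (k \<odot> \<tau>) = k * tvalue \<tau>"
  by (transfer, simp)+

primrec raw_base_change :: "nat \<Rightarrow> raw_term \<Rightarrow> raw_term" where
  "raw_base_change l RZero = RZero"
| "raw_base_change l ROne = ROne"
| "raw_base_change l (RAdd s t) = RAdd (raw_base_change l s) (raw_base_change l t)"
| "raw_base_change l (RMul k t) = RMul l (raw_base_change l t)"

lift_definition base_change :: "nat \<Rightarrow> mterm \<Rightarrow> mterm" is raw_base_change
  by (erule assoc_eq.induct) (auto intro: assoc_eq.intros)

lemma base_change_simps [simp]:
  "base_change l TZero = TZero"
  "base_change l TOne = TOne"
  "base_change l (\<sigma> \<oplus> \<tau>) = base_change l \<sigma> \<oplus> base_change l \<tau>"
  "base_change l (k \<odot> \<tau>) = l \<odot> base_change l \<tau>"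
  by (transfer, simp add: assoc_eq.refl)+

fun bar :: "nat \<Rightarrow> mterm" where
  "bar 0 = TZero"
| "bar (Suc 0) = TOne"
| "bar (Suc (Suc q)) = bar (Suc q) \<oplus> TOne"

text \<open>The disjunct \<open>k < 2\<close> only serves termination; \<open>nf k\<close> is meaningful for \<open>k \<ge> 2\<close>.\<close>

function nf :: "nat \<Rightarrow> nat \<Rightarrow> mterm" where
  "nf k m =
    (let p = m div k; q = m mod k in
     if p = 0 \<or> k < 2 then bar q
     else if q = 0 then k \<odot> nf k p
     else k \<odot> nf k p \<oplus> bar q)"
  by pat_completeness auto
termination
  by (relation "measure snd") (auto intro!: div_less_dividend simp: div_greater_zero_iff)

declare nf.simps [simp del]

text \<open>\<open>nat_base_change k l m\<close> is the paper's \<open>\<up>\<^sup>l\<^sub>k m\<close>.\<close>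

definition nat_base_change :: "nat \<Rightarrow> nat \<Rightarrow> nat \<Rightarrow> nat" where
  "nat_base_change k l m = tvalue (base_change l (nf k m))"

end

theory Submission
  imports Defs
begin

text \<open>
  Reading the normal form in base \<open>l\<close> interprets the base \<open>k\<close> digits of \<open>m\<close> as coefficients of powers of
  \<open>l\<close>, so \<open>f m = nat_base_change k l m\<close> satisfies \<open>f (k * p + q) = l * f p + q\<close> for
  \<open>q < k\<close> (\<open>nat_base_change_append_digit\<close>). The theorem holds because in the normal form every group of \<open>k\<close> units at
  a position has been traded for one unit at the next. Such a trade preserves the value in base \<open>k\<close>, but
  after the base change it turns \<open>k\<close> copies of \<open>l ^ i\<close> into one \<open>l ^ (i + 1)\<close>, a gain of
  \<open>(l - k) * l ^ i\<close>.

  The precise form of this gain is that \<open>f\<close> is superadditive (\<open>nat_base_change_superadditive\<close>), while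
  multiplication by the base is respected exactly: \<open>f (k * m) = l * f m\<close>. These two facts match the two
  operations that build terms, and so structural induction on \<open>\<tau>\<close> gives the bound.
\<close>

lemma tvalue_base_change_bar: "tvalue (base_change l (bar q)) = q"
  by (induction q rule: bar.induct) auto

lemma nat_base_change_less:
  "m < k \<Longrightarrow> nat_base_change k l m = m"
  by (simp add: nat_base_change_def nf.simps[of k m] tvalue_base_change_bar)

text \<open>
  The case distinctions in the normal form only suppress summands of value zero, so that after evaluation
  a single recursion equation covers all of them.
\<close>

lemma nat_base_change_append_digit:
  assumes "k \<ge> 2" and "q < k"
  shows "nat_base_change k l (k * p + q) = l * nat_base_change k l p + q"
proof (cases "p = 0")
  case True
  then show ?thesis
    using assms by (simp add: nat_base_change_less)
next
  case False
  then show ?thesis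
    using assms
    by (simp add: nat_base_change_def nf.simps[of k "k * p + q"] Let_def tvalue_base_change_bar)
qed

lemma nat_base_change_mult:
  "k \<ge> 2 \<Longrightarrow> nat_base_change k l (k * p) = l * nat_base_change k l p"
  using nat_base_change_append_digit[of k 0 l p] by simp

text \<open>
  This is schoolbook addition of the numerals of \<open>a\<close> and \<open>b\<close>. If the last digits produce no carry, both
  sides have the same last digit and the leading parts are compared by induction. If they do, the
  right-hand side loses \<open>k\<close> in the last digit and gains at least \<open>l\<close> from the carry. The induction is on
  \<open>a + b\<close> because the carry makes a further addition, of \<open>1\<close>, to the leading parts.
\<close>

lemma nat_base_change_superadditive:
  assumes "k \<ge> 2" and "k \<le> l"
  shows "nat_base_change k l a + nat_base_change k l b \<le> nat_base_change k l (a + b)"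
proof (induction "a + b" arbitrary: a b rule: less_induct)
  case less
  let ?f = "nat_base_change k l"
  define p q r s where "p = a div k" and "q = a mod k" and "r = b div k" and "s = b mod k"
  have a: "a = k * p + q" and b: "b = k * r + s" and q: "q < k" and s: "s < k"
    using assms(1) by (simp_all add: p_def q_def r_def s_def)
  have fa: "?f a = l * ?f p + q" and fb: "?f b = l * ?f r + s"
    unfolding a b by (rule nat_base_change_append_digit[OF assms(1) q] nat_base_change_append_digit[OF assms(1) s])+
  have sum: "a + b = k * (p + r) + (q + s)"
    by (simp add: a b algebra_simps)
  have grows: "n < k * n + c" if "n \<noteq> 0" for n c
  proof -
    have "n < 2 * n"
      using that by simp
    also have "2 * n \<le> k * n"
      using assms(1) by simp
    also have "k * n \<le> k * n + c"
      by (rule le_add1)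
    finally show ?thesis .
  qed
  show ?case
  proof (cases "q + s < k")
    case True
    have fab: "?f (a + b) = l * ?f (p + r) + (q + s)"
      unfolding sum using assms(1) True by (rule nat_base_change_append_digit)
    have "?f p + ?f r \<le> ?f (p + r)"
    proof (cases "p + r = 0")
      case True
      then show ?thesis
        using assms(1) by (simp add: nat_base_change_less)
    next
      case False
      then have "p + r < a + b"
        unfolding sum by (rule grows)
      then show ?thesis
        by (rule less)
    qed
    then have "l * (?f p + ?f r) \<le> l * ?f (p + r)"
      by (rule mult_le_mono2)
    then show ?thesis
      by (simp add: fa fb fab algebra_simps)
  next
    case False
    define d where "d = q + s - k"
    have d: "q + s = k + d" and "d < k"
      using False q s by (simp_all add: d_def)
    have sum': "a + b = k * (p + r + 1) + d"
      by (simp add: sum d)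
    have fab: "?f (a + b) = l * ?f (p + r + 1) + d"
      unfolding sum' using assms(1) \<open>d < k\<close> by (rule nat_base_change_append_digit)
    have smaller: "p + r + 1 < a + b"
      unfolding sum' by (rule grows) simp
    have "?f p + ?f r \<le> ?f (p + r)"
      using smaller by (intro less) simp
    moreover have "?f (p + r) + ?f 1 \<le> ?f (p + r + 1)"
      using smaller by (rule less)
    moreover have "?f 1 = 1"
      using assms(1) by (simp add: nat_base_change_less)
    ultimately have "?f p + ?f r + 1 \<le> ?f (p + r + 1)"
      by linarith
    then have "l * (?f p + ?f r + 1) \<le> l * ?f (p + r + 1)"
      by (rule mult_le_mono2)
    then have "l * ?f p + l * ?f r + l \<le> l * ?f (p + r + 1)"
      by (simp add: algebra_simps)
    then show ?thesis
      using d assms(2) unfolding fa fb fab by linarith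
  qed
qed

theorem theorem4p4:
  fixes k l m :: nat and \<tau> :: mterm
  assumes "l > k" and "k \<ge> 2"
    and "\<tau> \<in> mterms k"
    and "m = tvalue \<tau>"
  shows "nat_base_change k l m \<ge> tvalue (base_change l \<tau>)"
  using assms(3) unfolding assms(4)
proof (induction rule: mterms.induct)
  case zero
  then show ?case
    by simp
next
  case one
  then show ?case
    using assms(2) by (simp add: nat_base_change_less)
next
  case (add \<sigma> \<tau>)
  have "nat_base_change k l (tvalue \<sigma>) + nat_base_change k l (tvalue \<tau>)
      \<le> nat_base_change k l (tvalue \<sigma> + tvalue \<tau>)"
    using assms(1,2) by (intro nat_base_change_superadditive) simp_all
  with add.IH show ?case
    by simp
next
  case (mul \<tau>)
  then show ?case
    using assms(2) by (simp add: nat_base_change_mult)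
qed

end
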